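(* Let $S_1=(X_1,X_1,U_1,U_1,X_1,F_1,\mathrm{id})$ be a simple system with $F_1$ strict; let $P_1\colon\hat U_1\rightrightarrows U_1$, $P_2\colon X_1\rightrightarrows\hat X_1$, $P_3\colon\hat U_1\rightrightarrows Y_1$, $P_4\colon X_1\rightrightarrows Y_2$ be strict set-valued maps with nonempty domains (perturbation maps); let $Q\colon\hat X_1\rightrightarrows X_2$ be a strict set-valued map (quantizer); and let $C=(X_c,X_{c,0},X_2,V_c,\hat U_1,F_c,H_c)$ be a system (controller). Let $\Sigma_1$ be a specification on $Y_1\times Y_2$. Let $\hat S_1=(X_1,X_1,\hat U_1,\hat U_1,X_1,\hat F_1,\mathrm{id})$ be the simple system with $\hat F_1(x,u)=F_1(x,P_1(u))$, and let $\hat\Sigma_1$ be a specification on $\hat U_1\times X_1$ that is a robust specification of $\Sigma_1$ with respect to $P_3$ and $P_4$. If $C\circ\hat Q$, with $\hat Q=Q\circ P_2$, solves the control problem $(\hat S_1,\hat\Sigma_1)$, then the behavior of the perturbed closed loop formed by $S_1$, $P_1,\dots,P_4$, $Q$ and $C$ is a subset of $\Sigma_1$.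
   Context: Notation. $\mathbb{N}=\{1,2,\dots\}$, $\mathbb{Z}_+=\{0,1,2,\dots\}$. For $T\in\mathbb{Z}_+\cup\{\infty\}$, $[0;T[\,=\{t\in\mathbb{Z}_+: t<T\}$; $A^{[0;T[}$ is the set of maps $[0;T[\,\to A$, and $A^\infty=\bigcup_{T\in\mathbb{Z}_+\cup\{\infty\}}A^{[0;T[}$. $f\colon A\rightrightarrows B$ denotes a set-valued map; $f(M)=\bigcup_{a\in M}f(a)$ for $M\subseteq A$; $f$ is strict if $f(a)\neq\emptyset$ for all $a\in A$; $(f\circ g)(x)=f(g(x))$; $F_1(x,M)=\bigcup_{u\in M}F_1(x,u)$. Systems. A system is a septuple $S=(X,X_0,U,V,Y,F,H)$ where $X,X_0,U,V,Y$ are nonempty sets, $X_0\subseteq X$, $H\colon X\times U\rightrightarrows Y\times V$ is strict, and $F\colon X\times V\rightrightarrows X$. A solution of $S$ on $[0;T[$, $T\in\mathbb{N}\cup\{\infty\}$, is a quadruple $(u,v,x,y)\in U^{[0;T[}\times V^{[0;T[}\times X^{[0;T[}\times Y^{[0;T[}$ with $x(0)\in X_0$, $x(t+1)\in F(x(t),v(t))$ for all $t\in[0;T-1[$, and $(y(t),v(t))\in H(x(t),u(t))$ for all $t\in[0;T[$. $S$ is Moore if $(y,v)\in H(x,u)$ and $u'\in U$ imply that there is $v'$ with $(y,v')\in H(x,u')$. $S$ is simple if $U=V$, $X=Y$, $X_0=X$ and $H=\mathrm{id}$, i.e. $H(x,u)=\{(x,u)\}$. Behavior. $\mathcal{B}(S)$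 is the set of pairs $(u,y)$ for which there exist $v,x,T$ such that $(u,v,x,y)$ is a solution of $S$ on $[0;T[$ and, if $T<\infty$, then $F(x(T-1),v(T-1))=\emptyset$. Serial composition with a quantizer. If $S=(X,X_0,U,V,Y,F,H)$ is a system, $U'$ a nonempty set and $Q\colon U'\rightrightarrows U$ is strict, then $S\circ Q=(X,X_0,U',V,Y,F,H')$ with $H'(x,u')=H(x,Q(u'))=\bigcup_{u\in Q(u')}H(x,u)$. Feedback composition. Let $S_i=(X_i,X_{i,0},U_i,V_i,Y_i,F_i,H_i)$, $i\in\{1,2\}$, be systems. $S_1$ is feedback composable with $S_2$ if $S_2$ is Moore, $Y_2\subseteq U_1$, $Y_1\subseteq U_2$, and: whenever $(y_2,v_2)\in H_2(x_2,y_1)$, $(y_1,v_1)\in H_1(x_1,y_2)$ and $F_2(x_2,v_2)=\emptyset$, then $F_1(x_1,v_1)=\emptyset$. In that case the closed loop is $S_1\times S_2=(X_1\times X_2,X_{1,0}\times X_{2,0},\{0\},V_1\times V_2,Y_1\times Y_2,F_{12},H_{12})$ with $F_{12}(x,v)=F_1(x_1,v_1)\times F_2(x_2,v_2)$ and $H_{12}(x,0)=\{(y,v): (y_1,v_1)\in H_1(x_1,y_2)\wedge(y_2,v_2)\in H_2(x_2,y_1)\}$. Elements $(0,(y_1,y_2))$ of the behavior of $S_1\times S_2$ are identified with $(y_1,y_2)$. Control problems. A specification on a set $Z$ is a subset $\Sigma\subseteq Z^\infty$ (pairs of maps with common domain are identified with maps into the product). Given a system $S$ with input alphabet $U$ and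 output alphabet $Y$ and a specification $\Sigma$ on $U\times Y$, a system $C$ solves the control problem $(S,\Sigma)$ if $C$ is feedback composable with $S$ and $\mathcal{B}(C\times S)\subseteq\Sigma$. Perturbed closed loop. The behavior of the perturbed closed loop formed by $S_1,P_1,\dots,P_4,Q,C$ is the set of all $(y_1,y_2)\in(Y_1\times Y_2)^{[0;T[}$, $T\in\mathbb{N}\cup\{\infty\}$, for which there exist a solution $(u,u,x,x)$ of $S_1$ on $[0;T[$ and a solution $(u_c,v_c,x_c,y_c)$ of $C$ on $[0;T[$ such that: (1) for all $t\in[0;T[$: $u(t)\in P_1(y_c(t))$, $u_c(t)\in Q(P_2(x(t)))$, $y_1(t)\in P_3(y_c(t))$, $y_2(t)\in P_4(x(t))$; (2) if $T<\infty$, then $F_1(x(T-1),u(T-1))=\emptyset$ or $F_c(x_c(T-1),v_c(T-1))=\emptyset$. Robust specification. For specifications $\Sigma_1$ on $Y_1\times Y_2$ and $\hat\Sigma_1$ on $\hat U_1\times X_1$, $\hat\Sigma_1$ is a robust specification of $\Sigma_1$ with respect to $P_3$ and $P_4$ if for all $T\in\mathbb{N}\cup\{\infty\}$ and all $(y_c,x,y_1,y_2)\in(\hat U_1\times X_1\times Y_1\times Y_2)^{[0;T[}$: if $(y_c,x)\in\hat\Sigma_1$ and $y_1(t)\in P_3(y_c(t))$, $y_2(t)\in P_4(x(t))$ for all $t\in[0;T[$, then $(y_1,y_2)\in\Sigma_1$. *)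

theory Defs
  imports Main "HOL-Library.Extended_Nat"
begin

text \<open>Set-valued maps are total functions into sets whose values outside the domain
  \<open>A\<close> are irrelevant; every definition below only inspects values on the domain.\<close>

definition set_map :: "'a set \<Rightarrow> 'b set \<Rightarrow> ('a \<Rightarrow> 'b set) \<Rightarrow> bool" where
  "set_map A B f \<longleftrightarrow> (\<forall>a\<in>A. f a \<subseteq> B)"

definition strict_on :: "'a set \<Rightarrow> ('a \<Rightarrow> 'b set) \<Rightarrow> bool" where
  "strict_on A f \<longleftrightarrow> (\<forall>a\<in>A. f a \<noteq> {})"

definition set_image :: "('a \<Rightarrow> 'b set) \<Rightarrow> 'a set \<Rightarrow> 'b set" where
  "set_image f M = (\<Union>a\<in>M. f a)"

definition set_comp :: "('b \<Rightarrow> 'c set) \<Rightarrow> ('a \<Rightarrow> 'b set) \<Rightarrow> 'a \<Rightarrow> 'c set" where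
  "set_comp f g = (\<lambda>x. set_image f (g x))"

text \<open>A map on \<open>[0;T[\<close> is a partial map with that domain, so that maps on different
  intervals are different objects. \<open>sig_pair\<close> identifies a pair of maps with common domain
  with a map into the product.\<close>

definition interval :: "enat \<Rightarrow> nat set" where
  "interval T = {t. enat t < T}"

definition signals :: "enat \<Rightarrow> 'a set \<Rightarrow> (nat \<rightharpoonup> 'a) set" where
  "signals T A = {f. dom f = interval T \<and> ran f \<subseteq> A}"

definition sig_pair :: "(nat \<rightharpoonup> 'a) \<Rightarrow> (nat \<rightharpoonup> 'b) \<Rightarrow> (nat \<rightharpoonup> 'a \<times> 'b)" where
  "sig_pair f g = (\<lambda>t. if t \<in> dom f \<inter> dom g then Some (the (f t), the (g t)) else None)"

definition is_specification :: "'z set \<Rightarrow> (nat \<rightharpoonup> 'z) set \<Rightarrow> bool" where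
  "is_specification Z \<Sigma> \<longleftrightarrow> \<Sigma> \<subseteq> (\<Union>T. signals T Z)"

text \<open>The fields are \<open>X, X\<^sub>0, U, V, Y, F, H\<close>, in this order.\<close>

record ('x, 'u, 'v, 'y) system =
  states :: "'x set"
  init :: "'x set"
  inputs :: "'u set"
  internals :: "'v set"
  outputs :: "'y set"
  trans_map :: "'x \<times> 'v \<Rightarrow> 'x set"
  out_map :: "'x \<times> 'u \<Rightarrow> ('y \<times> 'v) set"

definition is_system :: "('x, 'u, 'v, 'y) system \<Rightarrow> bool" where
  "is_system S \<longleftrightarrow>
     states S \<noteq> {} \<and> init S \<noteq> {} \<and> inputs S \<noteq> {} \<and> internals S \<noteq> {} \<and> outputs S \<noteq> {} \<and>
     init S \<subseteq> states S \<and>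
     set_map (states S \<times> inputs S) (outputs S \<times> internals S) (out_map S) \<and>
     strict_on (states S \<times> inputs S) (out_map S) \<and>
     set_map (states S \<times> internals S) (states S) (trans_map S)"

definition is_solution ::
  "('x, 'u, 'v, 'y) system \<Rightarrow> enat \<Rightarrow> (nat \<rightharpoonup> 'u) \<Rightarrow> (nat \<rightharpoonup> 'v) \<Rightarrow> (nat \<rightharpoonup> 'x) \<Rightarrow> (nat \<rightharpoonup> 'y) \<Rightarrow> bool"
where
  "is_solution S T u v x y \<longleftrightarrow>
     T \<noteq> 0 \<and>
     u \<in> signals T (inputs S) \<and> v \<in> signals T (internals S) \<and>
     x \<in> signals T (states S) \<and> y \<in> signals T (outputs S) \<and>
     the (x 0) \<in> init S \<and>
     (\<forall>t. enat (t + 1) < T \<longrightarrow> the (x (t + 1)) \<in> trans_map S (the (x t), the (v t))) \<and>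
     (\<forall>t \<in> interval T. (the (y t), the (v t)) \<in> out_map S (the (x t), the (u t)))"

definition behavior :: "('x, 'u, 'v, 'y) system \<Rightarrow> ((nat \<rightharpoonup> 'u) \<times> (nat \<rightharpoonup> 'y)) set" where
  "behavior S = {(u, y). \<exists>v x T. is_solution S T u v x y \<and>
     (\<forall>n. T = enat (Suc n) \<longrightarrow> trans_map S (the (x n), the (v n)) = {})}"

definition moore :: "('x, 'u, 'v, 'y) system \<Rightarrow> bool" where
  "moore S \<longleftrightarrow> (\<forall>x \<in> states S. \<forall>u \<in> inputs S. \<forall>u' \<in> inputs S. \<forall>y v.
     (y, v) \<in> out_map S (x, u) \<longrightarrow> (\<exists>v'. (y, v') \<in> out_map S (x, u')))"

definition simple :: "('x, 'u, 'u, 'x) system \<Rightarrow> bool" where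
  "simple S \<longleftrightarrow> inputs S = internals S \<and> states S = outputs S \<and> init S = states S \<and>
     (\<forall>x \<in> states S. \<forall>u \<in> inputs S. out_map S (x, u) = {(x, u)})"

definition simple_system ::
  "'x set \<Rightarrow> 'u set \<Rightarrow> ('x \<times> 'u \<Rightarrow> 'x set) \<Rightarrow> ('x, 'u, 'u, 'x) system"
where
  "simple_system X U F = \<lparr>states = X, init = X, inputs = U, internals = U, outputs = X,
     trans_map = F, out_map = (\<lambda>(x, u). {(x, u)})\<rparr>"

definition serial_comp ::
  "('x, 'u, 'v, 'y) system \<Rightarrow> 'w set \<Rightarrow> ('w \<Rightarrow> 'u set) \<Rightarrow> ('x, 'w, 'v, 'y) system"
where
  "serial_comp S U' Q = \<lparr>states = states S, init = init S, inputs = U',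
     internals = internals S, outputs = outputs S, trans_map = trans_map S,
     out_map = (\<lambda>(x, u'). \<Union>u \<in> Q u'. out_map S (x, u))\<rparr>"

definition feedback_composable ::
  "('x1, 'y2, 'v1, 'y1) system \<Rightarrow> ('x2, 'y1, 'v2, 'y2) system \<Rightarrow> bool"
where
  "feedback_composable S1 S2 \<longleftrightarrow>
     moore S2 \<and> outputs S2 \<subseteq> inputs S1 \<and> outputs S1 \<subseteq> inputs S2 \<and>
     (\<forall>x1 \<in> states S1. \<forall>x2 \<in> states S2. \<forall>y1 \<in> outputs S1. \<forall>y2 \<in> outputs S2.
      \<forall>v1 \<in> internals S1. \<forall>v2 \<in> internals S2.
        (y2, v2) \<in> out_map S2 (x2, y1) \<and> (y1, v1) \<in> out_map S1 (x1, y2) \<and>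
        trans_map S2 (x2, v2) = {} \<longrightarrow> trans_map S1 (x1, v1) = {})"

definition closed_loop ::
  "('x1, 'y2, 'v1, 'y1) system \<Rightarrow> ('x2, 'y1, 'v2, 'y2) system \<Rightarrow>
   ('x1 \<times> 'x2, nat, 'v1 \<times> 'v2, 'y1 \<times> 'y2) system"
where
  "closed_loop S1 S2 = \<lparr>states = states S1 \<times> states S2, init = init S1 \<times> init S2,
     inputs = {0}, internals = internals S1 \<times> internals S2,
     outputs = outputs S1 \<times> outputs S2,
     trans_map = (\<lambda>((x1, x2), (v1, v2)). trans_map S1 (x1, v1) \<times> trans_map S2 (x2, v2)),
     out_map = (\<lambda>((x1, x2), _). {((y1, y2), (v1, v2)) | y1 y2 v1 v2.
        y1 \<in> outputs S1 \<and> y2 \<in> outputs S2 \<and> v1 \<in> internals S1 \<and> v2 \<in> internals S2 \<and>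
        (y1, v1) \<in> out_map S1 (x1, y2) \<and> (y2, v2) \<in> out_map S2 (x2, y1)})\<rparr>"

text \<open>The projection \<open>snd\<close> identifies an element \<open>(0, (y\<^sub>1, y\<^sub>2))\<close> of the behavior of a
  closed loop with \<open>(y\<^sub>1, y\<^sub>2)\<close>.\<close>

definition solves ::
  "('xc, 'y, 'vc, 'u) system \<Rightarrow> ('x, 'u, 'v, 'y) system \<Rightarrow> (nat \<rightharpoonup> 'u \<times> 'y) set \<Rightarrow> bool"
where
  "solves C S \<Sigma> \<longleftrightarrow> feedback_composable C S \<and> snd ` behavior (closed_loop C S) \<subseteq> \<Sigma>"

definition perturbed_behavior ::
  "'y1 set \<Rightarrow> 'y2 set \<Rightarrow> ('x, 'u, 'u, 'x) system \<Rightarrow>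
   ('uh \<Rightarrow> 'u set) \<Rightarrow> ('x \<Rightarrow> 'xh set) \<Rightarrow> ('uh \<Rightarrow> 'y1 set) \<Rightarrow> ('x \<Rightarrow> 'y2 set) \<Rightarrow>
   ('xh \<Rightarrow> 'x2 set) \<Rightarrow> ('xc, 'x2, 'vc, 'uh) system \<Rightarrow> (nat \<rightharpoonup> 'y1 \<times> 'y2) set"
where
  "perturbed_behavior Y1 Y2 S1 P1 P2 P3 P4 Q C =
     {sig_pair y1 y2 | y1 y2. \<exists>T u x uc vc xc yc.
        T \<noteq> 0 \<and> y1 \<in> signals T Y1 \<and> y2 \<in> signals T Y2 \<and>
        is_solution S1 T u u x x \<and> is_solution C T uc vc xc yc \<and>
        (\<forall>t \<in> interval T.
           the (u t) \<in> P1 (the (yc t)) \<and>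
           the (uc t) \<in> set_image Q (P2 (the (x t))) \<and>
           the (y1 t) \<in> P3 (the (yc t)) \<and>
           the (y2 t) \<in> P4 (the (x t))) \<and>
        (\<forall>n. T = enat (Suc n) \<longrightarrow>
           trans_map S1 (the (x n), the (u n)) = {} \<or>
           trans_map C (the (xc n), the (vc n)) = {})}"

definition robust_specification ::
  "'uh set \<Rightarrow> 'x set \<Rightarrow> 'y1 set \<Rightarrow> 'y2 set \<Rightarrow> ('uh \<Rightarrow> 'y1 set) \<Rightarrow> ('x \<Rightarrow> 'y2 set) \<Rightarrow>
   (nat \<rightharpoonup> 'y1 \<times> 'y2) set \<Rightarrow> (nat \<rightharpoonup> 'uh \<times> 'x) set \<Rightarrow> bool"
where
  "robust_specification Uh X1 Y1 Y2 P3 P4 \<Sigma>1 \<Sigma>h \<longleftrightarrow>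
     (\<forall>T yc x y1 y2. T \<noteq> 0 \<longrightarrow>
        yc \<in> signals T Uh \<longrightarrow> x \<in> signals T X1 \<longrightarrow> y1 \<in> signals T Y1 \<longrightarrow> y2 \<in> signals T Y2 \<longrightarrow>
        sig_pair yc x \<in> \<Sigma>h \<longrightarrow>
        (\<forall>t \<in> interval T. the (y1 t) \<in> P3 (the (yc t)) \<and> the (y2 t) \<in> P4 (the (x t))) \<longrightarrow>
        sig_pair y1 y2 \<in> \<Sigma>1)"

lemma simple_simple_system: "simple (simple_system X U F)"
  by (simp add: simple_def simple_system_def)

lemma is_system_simple_system:
  assumes "X \<noteq> {}" "U \<noteq> {}" "set_map (X \<times> U) X F"
  shows "is_system (simple_system X U F)"
  using assms by (auto simp: is_system_def simple_system_def set_map_def strict_on_def)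

lemma out_map_system:
  assumes "is_system S" "x \<in> states S" "u \<in> inputs S"
  shows "out_map S (x, u) \<noteq> {}" "out_map S (x, u) \<subseteq> outputs S \<times> internals S"
  using assms by (simp_all add: is_system_def set_map_def strict_on_def)

lemma is_system_serial_comp:
  assumes S: "is_system S" and "U' \<noteq> {}" and Q: "set_map U' (inputs S) Q" "strict_on U' Q"
  shows "is_system (serial_comp S U' Q)"
proof -
  let ?H = "out_map (serial_comp S U' Q)"
  have "?H (x, u') \<noteq> {} \<and> ?H (x, u') \<subseteq> outputs S \<times> internals S"
    if x: "x \<in> states S" and u': "u' \<in> U'" for x u'
  proof -
    have sub: "Q u' \<subseteq> inputs S" and ne: "Q u' \<noteq> {}"
      using Q u' by (simp_all add: set_map_def strict_on_def)
    obtain u where u: "u \<in> Q u'" using ne by blast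
    then have "out_map S (x, u) \<noteq> {}"
      using out_map_system(1)[OF S x] sub by blast
    moreover have "out_map S (x, w) \<subseteq> outputs S \<times> internals S" if "w \<in> Q u'" for w
      using out_map_system(2)[OF S x] sub that by blast
    ultimately show ?thesis
      using u unfolding serial_comp_def by (simp add: UN_subset_iff) blast
  qed
  moreover have "states (serial_comp S U' Q) = states S" "init (serial_comp S U' Q) = init S"
    "inputs (serial_comp S U' Q) = U'" "internals (serial_comp S U' Q) = internals S"
    "outputs (serial_comp S U' Q) = outputs S" "trans_map (serial_comp S U' Q) = trans_map S"
    by (simp_all add: serial_comp_def)
  ultimately show ?thesis
    using S \<open>U' \<noteq> {}\<close> by (simp add: is_system_def set_map_def strict_on_def)
qed

lemma is_system_closed_loop:
  assumes S1: "is_system S1" and S2: "is_system S2" and fc: "feedback_composable S1 S2"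
  shows "is_system (closed_loop S1 S2)"
proof -
  let ?S = "closed_loop S1 S2"
  have sub: "outputs S2 \<subseteq> inputs S1" "outputs S1 \<subseteq> inputs S2" and m: "moore S2"
    using fc by (simp_all add: feedback_composable_def)
  have H: "out_map ?S ((x1, x2), z) \<noteq> {}"
    if x: "x1 \<in> states S1" "x2 \<in> states S2" for x1 x2 z
  proof -
    obtain u where u: "u \<in> inputs S2"
      using S2 unfolding is_system_def by blast
    obtain y2 v where y2: "(y2, v) \<in> out_map S2 (x2, u)" "y2 \<in> outputs S2"
      using out_map_system[OF S2 x(2) u] by fast
    obtain y1 v1 where y1: "(y1, v1) \<in> out_map S1 (x1, y2)" "y1 \<in> outputs S1" "v1 \<in> internals S1"
      using out_map_system[OF S1 x(1), of y2] sub(1) y2(2) by fast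
    have i1: "y1 \<in> inputs S2" using sub(2) y1(2) by (rule subsetD)
    obtain v2 where v2: "(y2, v2) \<in> out_map S2 (x2, y1)"
      using m x(2) u i1 y2(1) unfolding moore_def by meson
    then have "v2 \<in> internals S2"
      using out_map_system(2)[OF S2 x(2) i1] by fast
    then have "((y1, y2), (v1, v2)) \<in> out_map ?S ((x1, x2), z)"
      using y1 y2(2) v2 by (simp add: closed_loop_def)
    then show ?thesis by (metis empty_iff)
  qed
  have sel: "states ?S = states S1 \<times> states S2" "init ?S = init S1 \<times> init S2" "inputs ?S = {0}"
    "internals ?S = internals S1 \<times> internals S2" "outputs ?S = outputs S1 \<times> outputs S2"
    by (simp_all add: closed_loop_def)
  have "strict_on (states ?S \<times> inputs ?S) (out_map ?S)"
    unfolding strict_on_def sel by (simp add: H)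
  moreover have "set_map (states ?S \<times> inputs ?S) (outputs ?S \<times> internals ?S) (out_map ?S)"
    unfolding set_map_def closed_loop_def by clarsimp
  moreover have "trans_map ?S ((x1, x2), (v1, v2)) \<subseteq> states S1 \<times> states S2"
    if "x1 \<in> states S1" "x2 \<in> states S2" "v1 \<in> internals S1" "v2 \<in> internals S2" for x1 x2 v1 v2
  proof -
    have "trans_map S1 (x1, v1) \<subseteq> states S1" "trans_map S2 (x2, v2) \<subseteq> states S2"
      using S1 S2 that by (simp_all add: is_system_def set_map_def)
    then show ?thesis by (simp add: closed_loop_def Sigma_mono)
  qed
  then have "set_map (states ?S \<times> internals ?S) (states ?S) (trans_map ?S)"
    unfolding set_map_def sel by simp
  moreover have "init ?S \<subseteq> states ?S"
    using S1 S2 unfolding is_system_def sel by (intro Sigma_mono) simp_all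
  moreover have "states ?S \<noteq> {}" "init ?S \<noteq> {}" "inputs ?S \<noteq> {}" "internals ?S \<noteq> {}" "outputs ?S \<noteq> {}"
    using S1 S2 unfolding is_system_def sel by simp_all
  ultimately show ?thesis
    unfolding is_system_def by (intro conjI)
qed

end

theory Submission
  imports Defs
begin

text \<open>A perturbed run is an exact run of a different closed loop. The measurement error \<open>P2\<close>
  and the quantizer \<open>Q\<close> only enlarge the set of inputs that \<open>C\<close> may receive in a state \<open>x\<close>
  of the plant, so a run of \<open>C\<close> under them is a run of \<open>C \<circ> (Q \<circ> P2)\<close> driven by \<open>x\<close> itself
  (\<open>is_solution_serial_comp\<close>). The actuator error \<open>P1\<close> only enlarges the set of successors,
  so a run of the plant under a perturbed control is a run of the inflated plant, with
  transition map \<open>F1(x, P1(u))\<close>, under the control \<open>u\<close> that the controller issued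
  (\<open>is_solution_inflated_plant\<close>). The two runs then feed each other exactly, and form a run
  of the closed loop (\<open>is_solution_closed_loop\<close>).

  Membership in the behavior also requires that a finite run cannot be prolonged. Since \<open>F1\<close> is
  strict, the plant never blocks, so a finite perturbed run stops because the
  controller blocks; this makes the product transition map of the closed loop empty too.
  Hence the pair of the issued control and the true state satisfies \<open>\<Sigma>h1\<close>, and robustness
  carries this over to the perturbed outputs.\<close>

lemma signals_domD: "f \<in> signals T A \<Longrightarrow> dom f = interval T"
  by (simp add: signals_def)

lemma signals_valueD:
  assumes "f \<in> signals T A" "t \<in> interval T"
  shows "the (f t) \<in> A"
proof -
  have "t \<in> dom f" using assms by (simp add: signals_domD)
  then obtain a where "f t = Some a" by blast
  then show ?thesis using assms(1) by (auto simp: signals_def ran_def)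
qed

lemma interval_step:
  assumes "enat (t + 1) < T"
  shows "t \<in> interval T" "t + 1 \<in> interval T"
  using assms by (auto simp: interval_def intro: order.strict_trans[rotated])

lemma zero_in_interval: "T \<noteq> 0 \<Longrightarrow> 0 \<in> interval T"
  by (simp add: interval_def flip: zero_enat_def)

lemma sig_pair_value:
  assumes "f \<in> signals T A" "g \<in> signals T B" "t \<in> interval T"
  shows "the (sig_pair f g t) = (the (f t), the (g t))"
proof -
  have "t \<in> dom f \<inter> dom g" using assms by (simp add: signals_domD)
  then show ?thesis unfolding sig_pair_def by simp
qed

lemma sig_pair_signals:
  assumes "f \<in> signals T A" "g \<in> signals T B"
  shows "sig_pair f g \<in> signals T (A \<times> B)"
proof -
  have "dom (sig_pair f g) = dom f \<inter> dom g"
    by (auto simp: sig_pair_def dom_def)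
  then have "dom (sig_pair f g) = interval T"
    using assms by (simp add: signals_domD)
  moreover have "ran (sig_pair f g) \<subseteq> A \<times> B"
    by (auto simp: ran_def sig_pair_def signals_domD[OF assms(1)] signals_domD[OF assms(2)]
        signals_valueD[OF assms(1)] signals_valueD[OF assms(2)] split: if_splits)
  ultimately show ?thesis by (simp add: signals_def)
qed

lemma is_solution_closed_loop:
  assumes 1: "is_solution S1 T y2 v1 x1 y1" and 2: "is_solution S2 T y1 v2 x2 y2"
  shows "is_solution (closed_loop S1 S2) T (\<lambda>t. if t \<in> interval T then Some 0 else None)
           (sig_pair v1 v2) (sig_pair x1 x2) (sig_pair y1 y2)"
proof -
  have T: "T \<noteq> 0" using 1 by (simp add: is_solution_def)
  have v: "v1 \<in> signals T (internals S1)" "v2 \<in> signals T (internals S2)"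
    and x: "x1 \<in> signals T (states S1)" "x2 \<in> signals T (states S2)"
    and y: "y1 \<in> signals T (outputs S1)" "y2 \<in> signals T (outputs S2)"
    using 1 2 by (simp_all add: is_solution_def)
  note val = sig_pair_value[OF v] sig_pair_value[OF x] sig_pair_value[OF y]
  have "the (sig_pair x1 x2 0) \<in> init (closed_loop S1 S2)"
    using 1 2 by (simp add: val zero_in_interval[OF T] is_solution_def closed_loop_def)
  moreover have "the (sig_pair x1 x2 (t + 1))
      \<in> trans_map (closed_loop S1 S2) (the (sig_pair x1 x2 t), the (sig_pair v1 v2 t))"
    if "enat (t + 1) < T" for t
    using 1 2 that interval_step[OF that] unfolding is_solution_def
    by (simp add: val closed_loop_def)
  moreover have "(the (sig_pair y1 y2 t), the (sig_pair v1 v2 t))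
      \<in> out_map (closed_loop S1 S2) (the (sig_pair x1 x2 t), a)"
    if "t \<in> interval T" for t a
    using 1 2 that signals_valueD[OF v(1) that] signals_valueD[OF v(2) that]
      signals_valueD[OF y(1) that] signals_valueD[OF y(2) that] unfolding is_solution_def
    by (simp add: val closed_loop_def)
  moreover have "(\<lambda>t. if t \<in> interval T then Some 0 else None) \<in> signals T {0}"
    by (auto simp: signals_def ran_def split: if_splits)
  ultimately show ?thesis
    using T sig_pair_signals[OF v] sig_pair_signals[OF x] sig_pair_signals[OF y]
    unfolding is_solution_def by (simp add: closed_loop_def)
qed

lemma is_solution_serial_comp:
  assumes "is_solution S T u v x y" and "w \<in> signals T W"
    and "\<And>t. t \<in> interval T \<Longrightarrow> the (u t) \<in> Q (the (w t))"
  shows "is_solution (serial_comp S W Q) T w v x y"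
  using assms unfolding is_solution_def serial_comp_def by auto

text \<open>As the internal signal of a simple system is its input signal, replacing the perturbed
  control \<open>u\<close> by the issued control \<open>w\<close> replaces both.\<close>

lemma is_solution_inflated_plant:
  assumes "is_solution S T u u x x" and "w \<in> signals T W"
    and "\<And>t. t \<in> interval T \<Longrightarrow> the (u t) \<in> P (the (w t))"
  shows "is_solution
    (simple_system (states S) W (\<lambda>(x, u). set_image (\<lambda>w. trans_map S (x, w)) (P u))) T w w x x"
  using assms interval_step(1)[of _ T] zero_in_interval[of T] signals_valueD[of x T "states S" 0]
  unfolding is_solution_def simple_system_def set_image_def by fastforce

lemma closed_loop_blocks:
  assumes "x1 \<in> signals T (states S1)" "x2 \<in> signals T (states S2)"
    and "v1 \<in> signals T (internals S1)" "v2 \<in> signals T (internals S2)"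
    and "t \<in> interval T" and "trans_map S1 (the (x1 t), the (v1 t)) = {}"
  shows "trans_map (closed_loop S1 S2) (the (sig_pair x1 x2 t), the (sig_pair v1 v2 t)) = {}"
  using assms by (simp add: sig_pair_value closed_loop_def)

theorem mainTheorem4:
  fixes S1 :: "('x1, 'u1, 'u1, 'x1) system"
    and C :: "('xc, 'x2, 'vc, 'uh1) system"
    and X1 :: "'x1 set" and U1 :: "'u1 set" and F1 :: "'x1 \<times> 'u1 \<Rightarrow> 'x1 set"
    and Uh1 :: "'uh1 set" and Xh1 :: "'xh1 set" and X2 :: "'x2 set"
    and Y1 :: "'y1 set" and Y2 :: "'y2 set"
    and P1 :: "'uh1 \<Rightarrow> 'u1 set" and P2 :: "'x1 \<Rightarrow> 'xh1 set"
    and P3 :: "'uh1 \<Rightarrow> 'y1 set" and P4 :: "'x1 \<Rightarrow> 'y2 set"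
    and Q :: "'xh1 \<Rightarrow> 'x2 set"
    and \<Sigma>1 :: "(nat \<rightharpoonup> 'y1 \<times> 'y2) set" and \<Sigma>h1 :: "(nat \<rightharpoonup> 'uh1 \<times> 'x1) set"
  assumes "is_system S1" and "simple S1"
    and "states S1 = X1" and "inputs S1 = U1" and "trans_map S1 = F1"
    and "strict_on (X1 \<times> U1) F1"
    and "Uh1 \<noteq> {}" and "X1 \<noteq> {}"
    and "set_map Uh1 U1 P1" and "strict_on Uh1 P1"
    and "set_map X1 Xh1 P2" and "strict_on X1 P2"
    and "set_map Uh1 Y1 P3" and "strict_on Uh1 P3"
    and "set_map X1 Y2 P4" and "strict_on X1 P4"
    and "set_map Xh1 X2 Q" and "strict_on Xh1 Q"
    and "is_system C" and "inputs C = X2" and "outputs C = Uh1"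
    and "is_specification (Y1 \<times> Y2) \<Sigma>1"
    and "is_specification (Uh1 \<times> X1) \<Sigma>h1"
    and "robust_specification Uh1 X1 Y1 Y2 P3 P4 \<Sigma>1 \<Sigma>h1"
    and "solves (serial_comp C X1 (set_comp Q P2))
           (simple_system X1 Uh1 (\<lambda>(x, u). set_image (\<lambda>w. F1 (x, w)) (P1 u))) \<Sigma>h1"
  shows "perturbed_behavior Y1 Y2 S1 P1 P2 P3 P4 Q C \<subseteq> \<Sigma>1"
proof
  let ?C = "serial_comp C X1 (set_comp Q P2)"
  let ?S = "simple_system X1 Uh1 (\<lambda>(x, u). set_image (\<lambda>w. F1 (x, w)) (P1 u))"
  fix z assume "z \<in> perturbed_behavior Y1 Y2 S1 P1 P2 P3 P4 Q C"
  then obtain y1 y2 T u x uc vc xc yc where z: "z = sig_pair y1 y2" and "T \<noteq> 0"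
    and y: "y1 \<in> signals T Y1" "y2 \<in> signals T Y2"
    and S: "is_solution S1 T u u x x" and C: "is_solution C T uc vc xc yc"
    and P: "\<forall>t \<in> interval T. the (u t) \<in> P1 (the (yc t)) \<and>
           the (uc t) \<in> set_image Q (P2 (the (x t))) \<and>
           the (y1 t) \<in> P3 (the (yc t)) \<and> the (y2 t) \<in> P4 (the (x t))"
    and stop: "\<forall>n. T = enat (Suc n) \<longrightarrow> trans_map S1 (the (x n), the (u n)) = {} \<or>
           trans_map C (the (xc n), the (vc n)) = {}"
    unfolding perturbed_behavior_def by blast
  have x: "x \<in> signals T X1" and u: "u \<in> signals T U1"
    using S \<open>states S1 = X1\<close> \<open>inputs S1 = U1\<close> by (simp_all add: is_solution_def)
  have yc: "yc \<in> signals T Uh1"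
    using C \<open>outputs C = Uh1\<close> by (simp add: is_solution_def)

  have C': "is_solution ?C T x vc xc yc"
    using C x P by (intro is_solution_serial_comp) (auto simp: set_comp_def)
  have S': "is_solution ?S T yc yc x x"
    using is_solution_inflated_plant[OF S yc, of P1] P \<open>states S1 = X1\<close> \<open>trans_map S1 = F1\<close>
    by simp
  have "trans_map (closed_loop ?C ?S) (the (sig_pair xc x n), the (sig_pair vc yc n)) = {}"
    if T: "T = enat (Suc n)" for n
  proof -
    have n: "n \<in> interval T" by (simp add: T interval_def)
    have "trans_map S1 (the (x n), the (u n)) \<noteq> {}"
      using \<open>strict_on (X1 \<times> U1) F1\<close> \<open>trans_map S1 = F1\<close> signals_valueD[OF x n]
        signals_valueD[OF u n] by (simp add: strict_on_def)
    then have "trans_map ?C (the (xc n), the (vc n)) = {}"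
      using stop T by (simp add: serial_comp_def)
    with C' S' n show ?thesis
      by (intro closed_loop_blocks) (simp_all add: is_solution_def)
  qed
  with is_solution_closed_loop[OF C' S']
  have "(\<lambda>t. if t \<in> interval T then Some 0 else None, sig_pair yc x)
      \<in> behavior (closed_loop ?C ?S)"
    unfolding behavior_def by blast
  then have "sig_pair yc x \<in> \<Sigma>h1"
    using \<open>solves ?C ?S \<Sigma>h1\<close> unfolding solves_def by force
  then show "z \<in> \<Sigma>1"
    using \<open>robust_specification Uh1 X1 Y1 Y2 P3 P4 \<Sigma>1 \<Sigma>h1\<close> \<open>T \<noteq> 0\<close> yc x y P
    unfolding z robust_specification_def by blast
qed

end
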